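(* Let $n$ and $q$ be positive integers, and let $E=\sum_{h=1}^q a_h T_h$ be a legal expression for $\vec s=(s_1,\dots,s_n)$, i.e. each $a_h\in\mathbf{Z}$ and each $T_h$ is a legal term for $\vec s$ ($1\le h\le q$). Let $L=\sum_{h=1}^q a_h r_h$ be the expression obtained by replacing each legal term $T_h$ by its corresponding rational function $r_h=r_h(x_1,\dots,x_n)$. Then $E$ vanishes identically (that is, $E=0$ for all real $s_1>1,\dots,s_n>1$) if and only if $L$ vanishes identically (that is, $L=0$ for all real $x_1>1,\dots,x_n>1$).
   Context: Multiple zeta function: for a positive integer $m$ and real $t_1,\dots,t_m$ with $t_1>1$ and $t_j\ge 1$ for all $j$, $$\zeta(t_1,\dots,t_m)=\sum_{k_1>k_2>\cdots>k_m>0}\ \prod_{j=1}^m k_j^{-t_j},$$ the sum being over all positive integers $k_1,\dots,k_m$ satisfying the indicated inequalities. Set partitions: for a finite non-empty set $S$, an unordered set partition of $S$ is a finite non-empty set $\{P_1,\dots,P_m\}$ of pairwise disjoint non-empty subsets of $S$ with union $S$; an ordered set partition of $S$ is a finite ordered tuple $(P_1,\dots,P_m)$ of pairwise disjoint non-empty subsets of $S$ with union $S$. Legal term: let $\vec s=(s_1,\dots,s_n)$ be an ordered tuple of $n$ real variables with $s_j>1$ for $1\le j\le n$. Let $\mathscr{P}=\{P_1,\dots,P_m\}$ be an unordered set partition of $\{1,2,\dots,n\}$, and for each $1\le k\le m$ let $\vec{P_k}=(P_k^{(1)},\dots,P_k^{(\alpha_k)})$ be an ordered set partition of $P_k$ (with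 $\alpha_k$ components). Put $t_k^{(r)}=\sum_{j\in P_k^{(r)}}s_j$ for $1\le r\le\alpha_k$. The legal term for $\vec s$ arising from these data is the product $$\prod_{k=1}^m\zeta\big(t_k^{(1)},t_k^{(2)},\dots,t_k^{(\alpha_k)}\big),$$ and every legal term for $\vec s$ arises this way from some such data. Legal expression: a legal expression for $\vec s$ is a finite $\mathbf{Z}$-linear combination of legal terms for $\vec s$. Corresponding rational function: the rational function corresponding to the legal term above is the function of $n$ real variables $x_1>1,\dots,x_n>1$ given by $$R(x_1,\dots,x_n)=\prod_{k=1}^m\prod_{\beta=1}^{\alpha_k}\bigg(\prod_{\lambda=1}^{\beta}\ \prod_{j\in P_k^{(\lambda)}}x_j-1\bigg)^{-1},$$ where in each factor the $1$ is subtracted from the full double product over $\lambda$ and $j$. *)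

theory Defs
  imports "HOL-Analysis.Analysis" "HOL-Library.Disjoint_Sets"
begin

definition multi_zeta :: "real list \<Rightarrow> real" where
  "multi_zeta t =
     infsum (\<lambda>k. \<Prod>j<length t. real (k ! j) powr (- (t ! j)))
       {k :: nat list. length k = length t \<and> sorted_wrt (>) k \<and> (\<forall>i\<in>set k. 0 < i)}"

definition ordered_set_partition :: "'a set \<Rightarrow> 'a set list \<Rightarrow> bool" where
  "ordered_set_partition S ps \<longleftrightarrow>
     {} \<notin> set ps \<and> disjoint_family_on (\<lambda>r. ps ! r) {..<length ps} \<and> \<Union> (set ps) = S"

text \<open>
  A legal term is represented by the data it arises from: an unordered partition \<open>P\<close> of
  \<open>{1..n}\<close> and a function \<open>v\<close> assigning to each block \<open>A \<in> P\<close> an ordered partition \<open>v A\<close>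
  of \<open>A\<close> (values of \<open>v\<close> outside \<open>P\<close> are irrelevant). The corresponding rational function
  is read off from the same data, not from the value of the term.
\<close>

definition legal_data :: "nat \<Rightarrow> nat set set \<Rightarrow> (nat set \<Rightarrow> nat set list) \<Rightarrow> bool" where
  "legal_data n P v \<longleftrightarrow>
     partition_on {1..n} P \<and> (\<forall>A\<in>P. ordered_set_partition A (v A))"

definition legal_term ::
    "nat set set \<Rightarrow> (nat set \<Rightarrow> nat set list) \<Rightarrow> (nat \<Rightarrow> real) \<Rightarrow> real" where
  "legal_term P v s = (\<Prod>A\<in>P. multi_zeta (map (\<lambda>B. \<Sum>j\<in>B. s j) (v A)))"

definition rational_fun ::
    "nat set set \<Rightarrow> (nat set \<Rightarrow> nat set list) \<Rightarrow> (nat \<Rightarrow> real) \<Rightarrow> real" where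
  "rational_fun P v x =
     (\<Prod>A\<in>P. \<Prod>b<length (v A). inverse ((\<Prod>l\<le>b. \<Prod>j\<in>v A ! l. x j) - 1))"

end

theory Submission imports Defs begin

text \<open>
  Both a legal term and its rational function are sums over the \<^emph>\<open>same\<close> set of integer points.
  Write \<open>\<nat>\<^sub>+\<close> for the positive integers. Legal data select the points \<open>k \<in> \<nat>\<^sub>+\<^sup>n\<close> that, inside each
  block of the unordered partition, are constant on every part of the ordered partition and
  strictly decrease from one part to the next (\<open>decreasing_along\<close>). Expanding the multiple zeta
  values gives
  \<open>legal_term = \<Sum> k selected. \<Prod>j. k j powr - s j\<close>
  directly. Expanding each factor \<open>1 / (X\<^sub>1 \<dots> X\<^sub>\<beta> - 1)\<close> as a geometric series
  \<open>\<Sum>m\<^sub>\<beta>\<ge>1. (X\<^sub>1 \<dots> X\<^sub>\<beta>) ^ - m\<^sub>\<beta>\<close> and collecting the exponent \<open>m\<^sub>\<lambda> + \<dots> + m\<^sub>\<alpha>\<close> of \<open>X\<^sub>\<lambda>\<close>,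
  which is positive and strictly decreasing in \<open>\<lambda>\<close>, gives
  \<open>rational_fun = \<Sum> k selected. \<Prod>j. x j ^ - k j\<close>
  (\<open>has_sum_decreasing_tuples\<close>). Hence \<open>E = \<Sum>k. c k * (\<Prod>j. k j powr - s j)\<close> and
  \<open>L = \<Sum>k. c k * (\<Prod>j. x j ^ - k j)\<close> with one coefficient function: \<open>c k\<close> is the sum of the
  \<open>a h\<close> whose data select \<open>k\<close>.

  It remains to see that each of the two sums vanishes identically exactly if \<open>c = 0\<close>. Both are
  multiple general Dirichlet series \<open>\<Sum>k. c k * (\<Prod>j. exp (- (\<mu> (k j) * \<sigma> j)))\<close> with bounded
  coefficients: \<open>\<mu> = ln\<close> and \<open>\<sigma> = s\<close> for the zeta values, \<open>\<mu> m = m\<close> and \<open>\<sigma> = ln x\<close> for the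
  rational functions. Such a series determines its coefficients
  (\<open>multiple_dirichlet_series_unique\<close>).
\<close>

section \<open>Products of nonnegative sums over function spaces\<close>

lemma has_sum_times_nonneg:
  fixes f :: "'a \<Rightarrow> real" and g :: "'b \<Rightarrow> real"
  assumes f: "(f has_sum a) A" and g: "(g has_sum b) B"
    and f0: "\<And>x. x \<in> A \<Longrightarrow> f x \<ge> 0" and g0: "\<And>y. y \<in> B \<Longrightarrow> g y \<ge> 0"
  shows "((\<lambda>(x, y). f x * g y) has_sum (a * b)) (A \<times> B)"
proof -
  have inner: "((\<lambda>y. (\<lambda>(x, y). f x * g y) (x, y)) has_sum (f x * b)) B" for x
    using has_sum_cmult_right[OF g, of "f x"] by simp
  have outer: "((\<lambda>x. f x * b) has_sum (a * b)) A"
    by (rule has_sum_cmult_left[OF f])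
  have "(\<lambda>(x, y). f x * g y) summable_on (A \<times> B)"
    by (rule summable_on_SigmaI[OF inner has_sum_imp_summable[OF outer]]) (auto simp: f0 g0)
  then show ?thesis
    using has_sum_SigmaI[OF inner outer] by blast
qed

text \<open>
  A function on a disjoint union is a pair of functions on the two parts, so this is
  \<open>has_sum_times_nonneg\<close> transported along that bijection.
\<close>

lemma has_sum_PiE_Un:
  fixes f g :: "('a \<Rightarrow> 'b) \<Rightarrow> real"
  assumes f: "(f has_sum a) (A \<rightarrow>\<^sub>E S)" and g: "(g has_sum b) (B \<rightarrow>\<^sub>E S)"
    and f0: "\<And>k. f k \<ge> 0" and g0: "\<And>k. g k \<ge> 0" and disj: "A \<inter> B = {}"
  shows "((\<lambda>k. f (restrict k A) * g (restrict k B)) has_sum (a * b)) (A \<union> B \<rightarrow>\<^sub>E S)"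
proof -
  have "((\<lambda>k. f (restrict k A) * g (restrict k B)) has_sum (a * b)) (A \<union> B \<rightarrow>\<^sub>E S) \<longleftrightarrow>
        ((\<lambda>(x, y). f x * g y) has_sum (a * b)) ((A \<rightarrow>\<^sub>E S) \<times> (B \<rightarrow>\<^sub>E S))"
  proof (rule has_sum_reindex_bij_witness[where
        j = "\<lambda>k. (restrict k A, restrict k B)" and
        i = "\<lambda>(x, y). \<lambda>j\<in>A \<union> B. if j \<in> A then x j else y j"], goal_cases)
    case (1 k)
    then show ?case by (auto simp: fun_eq_iff restrict_def PiE_def extensional_def)
  next
    case (2 k)
    then show ?case by auto
  next
    case (3 p)
    then show ?case using disj by (auto simp: fun_eq_iff restrict_def PiE_def extensional_def)
  next
    case (4 p)
    then show ?case by (auto simp: restrict_def PiE_def Pi_def extensional_def)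
  qed auto
  then show ?thesis
    using has_sum_times_nonneg[OF f g] f0 g0 by auto
qed

lemma has_sum_PiE_Union:
  fixes f :: "'a set \<Rightarrow> ('a \<Rightarrow> 'b) \<Rightarrow> real"
  assumes "finite P" "disjoint P"
    and "\<And>A. A \<in> P \<Longrightarrow> (f A has_sum t A) (A \<rightarrow>\<^sub>E S)" and "\<And>A k. f A k \<ge> 0"
  shows "((\<lambda>k. \<Prod>A\<in>P. f A (restrict k A)) has_sum (\<Prod>A\<in>P. t A)) (\<Union>P \<rightarrow>\<^sub>E S)"
  using assms
proof (induction P)
  case empty
  show ?case by (auto simp: has_sum_finite_iff)
next
  case (insert A P)
  let ?F = "\<lambda>k. \<Prod>B\<in>P. f B (restrict k B)"
  have disj: "A \<inter> \<Union>P = {}"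
    using insert.prems(1) insert.hyps by (auto simp: disjoint_def pairwise_def disjnt_def)
  have "(?F has_sum (\<Prod>B\<in>P. t B)) (\<Union>P \<rightarrow>\<^sub>E S)"
    using insert by (auto intro!: insert.IH simp: pairwise_insert disjoint_def)
  have "((\<lambda>k. f A (restrict k A) * ?F (restrict k (\<Union>P))) has_sum (t A * (\<Prod>B\<in>P. t B)))
          (A \<union> \<Union>P \<rightarrow>\<^sub>E S)"
    using insert.prems(2,3)
    by (intro has_sum_PiE_Un[where f = "f A" and g = ?F] \<open>(?F has_sum _) _\<close> disj)
       (auto intro!: prod_nonneg)
  moreover have "?F (restrict k (\<Union>P)) = ?F k" for k
    by (intro prod.cong refl arg_cong2[where f = f]) (auto simp: fun_eq_iff restrict_def)
  ultimately show ?case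
    by (simp only: prod.insert[OF insert.hyps] Union_insert)
qed

lemma summable_on_prod_PiE_nonneg:
  fixes w :: "'a \<Rightarrow> 'b \<Rightarrow> real"
  assumes "finite J" and "\<And>j. j \<in> J \<Longrightarrow> w j summable_on S" and "\<And>j m. w j m \<ge> 0"
  shows "(\<lambda>k. \<Prod>j\<in>J. w j (k j)) summable_on (J \<rightarrow>\<^sub>E S)"
  using assms
proof (induction J)
  case (insert i J)
  have "((\<lambda>(x, y). w i x * (\<Prod>j\<in>J. w j (y j))) summable_on (S \<times> (J \<rightarrow>\<^sub>E S)))"
    using insert
    by (intro has_sum_imp_summable[OF has_sum_times_nonneg[OF has_sum_infsum has_sum_infsum]])
       (auto intro!: prod_nonneg)
  moreover have "w i x * (\<Prod>j\<in>J. w j (y j)) = (\<Prod>j\<in>insert i J. w j ((y(i := x)) j))" for x y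
    using insert.hyps by (auto intro!: prod.cong arg_cong2[where f = "(*)"])
  ultimately show ?case
    unfolding PiE_insert_eq
      summable_on_reindex[OF inj_combinator[OF insert.hyps(2), where T = "\<lambda>_. S"]]
    by (simp add: o_def case_prod_unfold)
qed simp

section \<open>Legal data as a selection of integer points\<close>

definition decreasing_tuples :: "nat \<Rightarrow> nat list set" where
  "decreasing_tuples \<alpha> = {k. length k = \<alpha> \<and> sorted_wrt (>) k \<and> (\<forall>i\<in>set k. 0 < i)}"

text \<open>
  The witness \<open>ks\<close> is the list of values of \<open>k\<close> on the successive parts; naming it turns the sum
  over such \<open>k\<close> into the sum that defines a multiple zeta value.
\<close>

definition decreasing_along :: "'a set list \<Rightarrow> ('a \<Rightarrow> nat) \<Rightarrow> bool" where
  "decreasing_along ps k \<longleftrightarrow>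
     (\<exists>ks\<in>decreasing_tuples (length ps). \<forall>r<length ps. \<forall>j\<in>ps ! r. k j = ks ! r)"

text \<open>
  Since the parts of \<open>ps\<close> are nonempty and disjoint with union \<open>A\<close>, decreasing tuples correspond
  bijectively to the functions on \<open>A\<close> that decrease along \<open>ps\<close>: a tuple assigns its \<open>r\<close>-th entry
  to every element of the \<open>r\<close>-th part.
\<close>

lemma infsum_decreasing_along:
  fixes w :: "'a \<Rightarrow> nat \<Rightarrow> real"
  assumes ps: "ordered_set_partition A ps" and "finite A"
  shows "(\<Sum>\<^sub>\<infinity>ks\<in>decreasing_tuples (length ps). \<Prod>r<length ps. \<Prod>j\<in>ps ! r. w j (ks ! r)) =
         (\<Sum>\<^sub>\<infinity>k\<in>{k\<in>A \<rightarrow>\<^sub>E {0<..}. decreasing_along ps k}. \<Prod>j\<in>A. w j (k j))"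
proof -
  define idx where "idx j = (THE r. r < length ps \<and> j \<in> ps ! r)" for j
  define \<phi> where "\<phi> ks = (\<lambda>j\<in>A. ks ! idx j)" for ks :: "nat list"
  let ?D = "decreasing_tuples (length ps)"
  have disj: "ps ! r \<inter> ps ! r' = {}" if "r < length ps" "r' < length ps" "r \<noteq> r'" for r r'
    using ps that unfolding ordered_set_partition_def disjoint_family_on_def by auto
  have idx: "idx j = r" if "r < length ps" "j \<in> ps ! r" for j r
    unfolding idx_def using that disj[of r] by (intro the_equality) auto
  have A_eq: "A = (\<Union>r<length ps. ps ! r)"
    using ps unfolding ordered_set_partition_def by (auto simp: set_conv_nth)
  have \<phi>: "\<phi> ks j = ks ! r" if "r < length ps" "j \<in> ps ! r" for ks j r
    using that idx A_eq unfolding \<phi>_def by auto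
  \<comment> \<open>Empty parts would not record their entry: injectivity is where nonemptiness enters.\<close>
  have "inj_on \<phi> ?D"
  proof (rule inj_onI)
    fix ks ks' assume *: "ks \<in> ?D" "ks' \<in> ?D" "\<phi> ks = \<phi> ks'"
    show "ks = ks'"
    proof (rule nth_equalityI)
      fix r assume "r < length ks"
      then have r: "r < length ps" using * by (simp add: decreasing_tuples_def)
      then have "ps ! r \<noteq> {}" using ps unfolding ordered_set_partition_def by (metis nth_mem)
      then obtain j where "j \<in> ps ! r" by blast
      with \<phi>[OF r this, of ks] \<phi>[OF r this, of ks'] * show "ks ! r = ks' ! r" by simp
    qed (use * in \<open>auto simp: decreasing_tuples_def\<close>)
  qed
  moreover have "\<phi> ` ?D = {k\<in>A \<rightarrow>\<^sub>E {0<..}. decreasing_along ps k}"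
  proof (intro equalityI subsetI)
    fix k assume "k \<in> \<phi> ` ?D"
    then obtain ks where ks: "ks \<in> ?D" "k = \<phi> ks" by blast
    have "decreasing_along ps k"
      unfolding decreasing_along_def using ks \<phi> by auto
    moreover have "k j > 0" if "j \<in> A" for j
      using that A_eq ks \<phi> by (auto simp: decreasing_tuples_def)
    ultimately show "k \<in> {k\<in>A \<rightarrow>\<^sub>E {0<..}. decreasing_along ps k}"
      using ks by (auto simp: \<phi>_def)
  next
    fix k assume k: "k \<in> {k\<in>A \<rightarrow>\<^sub>E {0<..}. decreasing_along ps k}"
    then obtain ks where ks: "ks \<in> ?D" "\<forall>r<length ps. \<forall>j\<in>ps ! r. k j = ks ! r"
      unfolding decreasing_along_def by auto
    have "k = \<phi> ks"
    proof
      fix j show "k j = \<phi> ks j"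
      proof (cases "j \<in> A")
        case True
        then show ?thesis using A_eq \<phi> ks by auto
      next
        case False
        then show ?thesis using k by (auto simp: \<phi>_def)
      qed
    qed
    then show "k \<in> \<phi> ` ?D" using ks by blast
  qed
  ultimately have bij: "bij_betw \<phi> ?D {k\<in>A \<rightarrow>\<^sub>E {0<..}. decreasing_along ps k}"
    by (simp add: bij_betw_def)
  have prod_eq: "(\<Prod>j\<in>A. w j (\<phi> ks j)) = (\<Prod>r<length ps. \<Prod>j\<in>ps ! r. w j (ks ! r))" for ks
  proof -
    have "(\<Prod>j\<in>A. w j (\<phi> ks j)) = (\<Prod>r<length ps. \<Prod>j\<in>ps ! r. w j (\<phi> ks j))"
      unfolding A_eq using disj \<open>finite A\<close> A_eq
      by (intro prod.UNION_disjoint) (auto intro: finite_subset)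
    then show ?thesis using \<phi> by simp
  qed
  show ?thesis
    using infsum_reindex_bij_betw[OF bij, of "\<lambda>k. \<Prod>j\<in>A. w j (k j)"] by (simp add: prod_eq)
qed

lemma decreasing_along_restrict:
  assumes "ordered_set_partition A ps"
  shows "decreasing_along ps (restrict k A) \<longleftrightarrow> decreasing_along ps k"
proof -
  have "ps ! r \<subseteq> A" if "r < length ps" for r
    using assms that unfolding ordered_set_partition_def by (metis Union_upper nth_mem)
  then have "restrict k A j = k j" if "r < length ps" "j \<in> ps ! r" for r j
    using that by auto
  then show ?thesis
    unfolding decreasing_along_def by metis
qed

text \<open>
  The expansion common to legal terms and rational functions, for arbitrary weights \<open>w\<close>: the
  blocks of \<open>P\<close> constrain disjoint sets of coordinates, so the product over the blocks of the
  sums over decreasing tuples is a single sum over the selected points.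
\<close>

lemma has_sum_legal_data:
  fixes w :: "nat \<Rightarrow> nat \<Rightarrow> real"
  assumes legal: "legal_data n P v"
    and w: "\<And>j. j \<in> {1..n} \<Longrightarrow> w j summable_on {0<..}" and w0: "\<And>j m. w j m \<ge> 0"
  shows "((\<lambda>k. of_bool (\<forall>A\<in>P. decreasing_along (v A) k) * (\<Prod>j\<in>{1..n}. w j (k j))) has_sum
          (\<Prod>A\<in>P. \<Sum>\<^sub>\<infinity>ks\<in>decreasing_tuples (length (v A)).
             \<Prod>r<length (v A). \<Prod>j\<in>v A ! r. w j (ks ! r))) ({1..n} \<rightarrow>\<^sub>E {0<..})"
proof -
  define f where "f A k = of_bool (decreasing_along (v A) k) * (\<Prod>j\<in>A. w j (k j))" for A k
  let ?t = "\<lambda>A. \<Sum>\<^sub>\<infinity>ks\<in>decreasing_tuples (length (v A)).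
              \<Prod>r<length (v A). \<Prod>j\<in>v A ! r. w j (ks ! r)"
  have P: "partition_on {1..n} P" and v: "\<And>A. A \<in> P \<Longrightarrow> ordered_set_partition A (v A)"
    using legal by (auto simp: legal_data_def)
  then have Un: "\<Union>P = {1..n}" and disj: "disjoint P"
    by (auto simp: partition_on_def)
  have "finite P" by (metis P finite_atLeastAtMost finite_elements)
  have fin: "finite A" if "A \<in> P" for A
    using that Un by (metis Union_upper finite_atLeastAtMost finite_subset)
  have "(f A has_sum ?t A) (A \<rightarrow>\<^sub>E {0<..})" if "A \<in> P" for A
  proof -
    let ?B = "{k\<in>A \<rightarrow>\<^sub>E {0<..}. decreasing_along (v A) k}"
    have "A \<subseteq> {1..n}" using that Un by blast
    then have "(\<lambda>k. \<Prod>j\<in>A. w j (k j)) summable_on (A \<rightarrow>\<^sub>E {0<..})"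
      using fin[OF that] w w0 by (intro summable_on_prod_PiE_nonneg) blast+
    then have "(\<lambda>k. \<Prod>j\<in>A. w j (k j)) summable_on ?B"
      by (rule summable_on_subset_banach) auto
    then have "((\<lambda>k. \<Prod>j\<in>A. w j (k j)) has_sum ?t A) ?B"
      unfolding infsum_decreasing_along[OF v[OF that] fin[OF that]] by simp
    also have "?this \<longleftrightarrow> ?thesis"
      by (intro has_sum_cong_neutral) (auto simp: f_def)
    finally show ?thesis .
  qed
  moreover have "f A k \<ge> 0" for A k
    by (auto simp: f_def w0 prod_nonneg)
  ultimately have "((\<lambda>k. \<Prod>A\<in>P. f A (restrict k A)) has_sum (\<Prod>A\<in>P. ?t A)) (\<Union>P \<rightarrow>\<^sub>E {0<..})"
    using \<open>finite P\<close> disj by (intro has_sum_PiE_Union)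
  moreover have "(\<Prod>A\<in>P. f A (restrict k A)) =
      of_bool (\<forall>A\<in>P. decreasing_along (v A) k) * (\<Prod>j\<in>{1..n}. w j (k j))" for k
  proof -
    have "(\<Prod>A\<in>P. f A (restrict k A)) =
          (\<Prod>A\<in>P. of_bool (decreasing_along (v A) k)) * (\<Prod>A\<in>P. \<Prod>j\<in>A. w j (k j))"
      unfolding prod.distrib[symmetric]
      by (intro prod.cong) (auto simp: f_def decreasing_along_restrict v)
    moreover have "(\<Prod>A\<in>P. \<Prod>j\<in>A. w j (k j)) = (\<Prod>j\<in>\<Union>P. w j (k j))"
      using fin disj by (subst prod.Union_disjoint) (auto simp: disjoint_def pairwise_def disjnt_def)
    moreover have "(\<Prod>A\<in>P. of_bool (decreasing_along (v A) k)) =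
        (of_bool (\<forall>A\<in>P. decreasing_along (v A) k) :: real)"
      using \<open>finite P\<close> by (induction P) auto
    ultimately show ?thesis by (simp add: Un)
  qed
  ultimately show ?thesis by (simp add: Un)
qed

section \<open>Uniqueness of Dirichlet series\<close>

text \<open>
  The coefficients are shown to vanish one after the other. If those before \<open>m\<close> are zero,
  multiplying the series by \<open>exp (\<mu> m * \<sigma>)\<close> makes its leading term the constant \<open>c m\<close>, while
  the tail is \<open>O(exp (- (\<delta> * \<sigma>)))\<close> with \<open>\<delta> = \<mu> (m + 1) - \<mu> m > 0\<close> and so disappears as
  \<open>\<sigma>\<close> tends to infinity.
\<close>

lemma general_dirichlet_series_unique:
  fixes \<mu> c :: "nat \<Rightarrow> real"
  assumes mono: "strict_mono_on {0<..} \<mu>"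
    and summable: "\<And>\<sigma>. \<sigma> > \<sigma>\<^sub>0 \<Longrightarrow> (\<lambda>m. exp (- (\<mu> m * \<sigma>))) summable_on {0<..}"
    and bound: "\<And>m. m > 0 \<Longrightarrow> \<bar>c m\<bar> \<le> B"
    and zero: "\<And>\<sigma>. \<sigma> > \<sigma>\<^sub>0 \<Longrightarrow> (\<Sum>\<^sub>\<infinity>m\<in>{0<..}. c m * exp (- (\<mu> m * \<sigma>))) = 0"
    and "m > 0"
  shows "c m = 0"
  using \<open>m > 0\<close>
proof (induction m rule: less_induct)
  case (less m)
  define e where "e k \<sigma> = exp (- ((\<mu> k - \<mu> m) * \<sigma>))" for k \<sigma>
  \<comment> \<open>A fixed point of convergence at which the tail is compared; any value above \<open>\<sigma>\<^sub>0\<close> serves.\<close>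
  define \<tau> where "\<tau> = \<sigma>\<^sub>0 + 1"
  define \<delta> where "\<delta> = \<mu> (Suc m) - \<mu> m"
  define T where "T = (\<Sum>\<^sub>\<infinity>k\<in>{m<..}. e k \<tau>)"
  have "\<delta> > 0"
    using strict_mono_onD[OF mono, of m "Suc m"] less.prems by (simp add: \<delta>_def)
  have e_alt: "e k \<sigma> = exp (\<mu> m * \<sigma>) * exp (- (\<mu> k * \<sigma>))" for k \<sigma>
    by (simp add: e_def algebra_simps flip: exp_add)
  have "B \<ge> 0" using bound[of m] less.prems by simp
  have e_summable: "(\<lambda>k. e k \<sigma>) summable_on {0<..}" if "\<sigma> > \<sigma>\<^sub>0" for \<sigma>
    unfolding e_alt by (intro summable_on_cmult_right summable that)
  have ineq: "\<bar>c m\<bar> \<le> B * T * exp (- (\<delta> * (\<sigma> - \<tau>)))" if "\<sigma> \<ge> \<tau>" for \<sigma>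
  proof -
    have "\<sigma> > \<sigma>\<^sub>0" using that by (simp add: \<tau>_def)
    have summ: "(\<lambda>k. c k * e k \<sigma>) summable_on {0<..}"
    proof (rule abs_summable_summable[OF Infinite_Sum.abs_summable_on_comparison_test'])
      show "(\<lambda>k. B * e k \<sigma>) summable_on {0<..}"
        by (intro summable_on_cmult_right e_summable) fact
      show "norm (c k * e k \<sigma>) \<le> B * e k \<sigma>" if "k \<in> {0<..}" for k
        using bound[of k] that by (auto simp: abs_mult e_def intro!: mult_right_mono)
    qed
    have "0 = (\<Sum>\<^sub>\<infinity>k\<in>{0<..}. exp (\<mu> m * \<sigma>) * (c k * exp (- (\<mu> k * \<sigma>))))"
      using zero[OF \<open>\<sigma> > \<sigma>\<^sub>0\<close>] by (simp add: infsum_cmult_right')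
    also have "\<dots> = (\<Sum>\<^sub>\<infinity>k\<in>{0<..}. c k * e k \<sigma>)"
      by (simp add: e_alt mult_ac)
    also have "\<dots> = (\<Sum>\<^sub>\<infinity>k\<in>insert m {m<..}. c k * e k \<sigma>)"
      using less by (intro infsum_cong_neutral) auto
    also have "\<dots> = c m + (\<Sum>\<^sub>\<infinity>k\<in>{m<..}. c k * e k \<sigma>)"
      using summable_on_subset_banach[OF summ, of "{m<..}"]
      by (subst infsum_insert) (auto simp: e_def)
    finally have "\<bar>c m\<bar> = norm (\<Sum>\<^sub>\<infinity>k\<in>{m<..}. c k * e k \<sigma>)" by simp
    also have "\<dots> \<le> (\<Sum>\<^sub>\<infinity>k\<in>{m<..}. (B * exp (- (\<delta> * (\<sigma> - \<tau>)))) * e k \<tau>)"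
    proof (rule norm_infsum_le)
      show "((\<lambda>k. c k * e k \<sigma>) has_sum (\<Sum>\<^sub>\<infinity>k\<in>{m<..}. c k * e k \<sigma>)) {m<..}"
        by (intro has_sum_infsum summable_on_subset_banach[OF summ]) auto
      show "((\<lambda>k. (B * exp (- (\<delta> * (\<sigma> - \<tau>)))) * e k \<tau>) has_sum
             (\<Sum>\<^sub>\<infinity>k\<in>{m<..}. (B * exp (- (\<delta> * (\<sigma> - \<tau>)))) * e k \<tau>)) {m<..}"
        by (intro has_sum_infsum summable_on_cmult_right
            summable_on_subset_banach[OF e_summable[of \<tau>]]) (auto simp: \<tau>_def)
      fix k assume k: "k \<in> {m<..}"
      have "\<mu> (Suc m) \<le> \<mu> k"
        using strict_mono_on_leD[OF mono, of "Suc m" k] k by auto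
      then have "\<delta> * (\<sigma> - \<tau>) \<le> (\<mu> k - \<mu> m) * (\<sigma> - \<tau>)"
        using that by (intro mult_right_mono) (auto simp: \<delta>_def)
      then have "e k \<sigma> \<le> exp (- (\<delta> * (\<sigma> - \<tau>))) * e k \<tau>"
        by (simp add: e_def algebra_simps flip: exp_add)
      then show "norm (c k * e k \<sigma>) \<le> (B * exp (- (\<delta> * (\<sigma> - \<tau>)))) * e k \<tau>"
        using bound[of k] k \<open>B \<ge> 0\<close> by (auto simp: abs_mult e_def mult.assoc intro!: mult_mono)
    qed
    also have "\<dots> = B * T * exp (- (\<delta> * (\<sigma> - \<tau>)))"
      by (simp add: infsum_cmult_right' T_def)
    finally show ?thesis .
  qed
  have "((\<lambda>\<sigma>. B * T * exp (- (\<delta> * (\<sigma> - \<tau>)))) \<longlongrightarrow> B * T * 0) at_top"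
  proof (intro tendsto_mult tendsto_const)
    have "LIM \<sigma> at_top. \<delta> * (- \<tau> + \<sigma>) :> at_top"
      by (intro filterlim_tendsto_pos_mult_at_top[OF tendsto_const \<open>\<delta> > 0\<close>]
          filterlim_tendsto_add_at_top[OF tendsto_const] filterlim_ident)
    then have "LIM \<sigma> at_top. - (\<delta> * (\<sigma> - \<tau>)) :> at_bot"
      by (simp add: filterlim_uminus_at_bot)
    then show "((\<lambda>\<sigma>. exp (- (\<delta> * (\<sigma> - \<tau>)))) \<longlongrightarrow> 0) at_top"
      by (rule filterlim_compose[OF exp_at_bot])
  qed
  then have "\<bar>c m\<bar> \<le> B * T * 0"
    by (rule tendsto_lowerbound)
       (auto intro!: eventually_mono[OF eventually_ge_at_top[of \<tau>]] ineq)
  then show "c m = 0" by simp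
qed

text \<open>
  Induction on the set of variables. Summing first over all variables but \<open>i\<close> leaves a Dirichlet
  series in \<open>\<sigma> i\<close> whose coefficients are again bounded, so each of these coefficients vanishes;
  they are themselves series of the same kind in the remaining variables.
\<close>

lemma multiple_dirichlet_series_unique:
  fixes \<mu> :: "nat \<Rightarrow> real" and c :: "('a \<Rightarrow> nat) \<Rightarrow> real"
  assumes "finite J" and mono: "strict_mono_on {0<..} \<mu>"
    and summable: "\<And>\<sigma>. \<sigma> > \<sigma>\<^sub>0 \<Longrightarrow> (\<lambda>m. exp (- (\<mu> m * \<sigma>))) summable_on {0<..}"
    and "\<And>k. \<bar>c k\<bar> \<le> B"
    and "\<And>\<sigma>. (\<forall>j\<in>J. \<sigma> j > \<sigma>\<^sub>0) \<Longrightarrow>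
           (\<Sum>\<^sub>\<infinity>k\<in>J \<rightarrow>\<^sub>E {0<..}. c k * (\<Prod>j\<in>J. exp (- (\<mu> (k j) * \<sigma> j)))) = 0"
    and "k \<in> J \<rightarrow>\<^sub>E {0<..}"
  shows "c k = 0"
  using assms(1,4-)
proof (induction J arbitrary: c k)
  case empty
  then show ?case by auto
next
  case (insert i J)
  define W where "W y \<sigma> = (\<Prod>j\<in>J. exp (- (\<mu> (y j) * \<sigma> j)))" for y and \<sigma> :: "'a \<Rightarrow> real"
  define m where "m = k i"
  define y where "y = restrict k J"
  have k: "k = y(i := m)"
    using insert.prems(3) by (auto simp: fun_eq_iff y_def m_def restrict_def PiE_def extensional_def)
  have m: "m > 0" and y: "y \<in> J \<rightarrow>\<^sub>E {0<..}"
    using insert.prems(3) by (auto simp: m_def y_def)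
  have W_summable: "(\<lambda>y. W y \<sigma>) summable_on (J \<rightarrow>\<^sub>E {0<..})" if "\<forall>j\<in>J. \<sigma> j > \<sigma>\<^sub>0" for \<sigma>
    unfolding W_def using insert.hyps that by (intro summable_on_prod_PiE_nonneg summable) auto
  have W_nonneg: "W y \<sigma> \<ge> 0" for y \<sigma> by (auto simp: W_def prod_nonneg)
  have "(\<Sum>\<^sub>\<infinity>y\<in>J \<rightarrow>\<^sub>E {0<..}. c (y(i := m)) * W y \<sigma>) = 0" if \<sigma>: "\<forall>j\<in>J. \<sigma> j > \<sigma>\<^sub>0" for \<sigma>
  proof (rule general_dirichlet_series_unique[OF mono summable _ _ m,
        where c = "\<lambda>m. \<Sum>\<^sub>\<infinity>y\<in>J \<rightarrow>\<^sub>E {0<..}. c (y(i := m)) * W y \<sigma>" and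
              B = "\<Sum>\<^sub>\<infinity>y\<in>J \<rightarrow>\<^sub>E {0<..}. B * W y \<sigma>"])
    fix m
    have "norm (\<Sum>\<^sub>\<infinity>y\<in>J \<rightarrow>\<^sub>E {0<..}. c (y(i := m)) * W y \<sigma>) \<le> (\<Sum>\<^sub>\<infinity>y\<in>J \<rightarrow>\<^sub>E {0<..}. B * W y \<sigma>)"
    proof (rule norm_infsum_le)
      have "(\<lambda>y. B * W y \<sigma>) summable_on (J \<rightarrow>\<^sub>E {0<..})"
        by (intro summable_on_cmult_right W_summable \<sigma>)
      then show "((\<lambda>y. B * W y \<sigma>) has_sum (\<Sum>\<^sub>\<infinity>y\<in>J \<rightarrow>\<^sub>E {0<..}. B * W y \<sigma>)) (J \<rightarrow>\<^sub>E {0<..})"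
        by simp
      show le: "norm (c (y(i := m)) * W y \<sigma>) \<le> B * W y \<sigma>" for y
        using insert.prems(1) W_nonneg by (auto simp: abs_mult intro!: mult_right_mono)
      have "(\<lambda>y. c (y(i := m)) * W y \<sigma>) summable_on (J \<rightarrow>\<^sub>E {0<..})"
        by (rule abs_summable_summable[OF Infinite_Sum.abs_summable_on_comparison_test'[OF \<open>(\<lambda>y. B * W y \<sigma>) summable_on _\<close> le]])
      then show "((\<lambda>y. c (y(i := m)) * W y \<sigma>) has_sum
          (\<Sum>\<^sub>\<infinity>y\<in>J \<rightarrow>\<^sub>E {0<..}. c (y(i := m)) * W y \<sigma>)) (J \<rightarrow>\<^sub>E {0<..})"
        by simp
    qed
    then show "\<bar>\<Sum>\<^sub>\<infinity>y\<in>J \<rightarrow>\<^sub>E {0<..}. c (y(i := m)) * W y \<sigma>\<bar> \<le> (\<Sum>\<^sub>\<infinity>y\<in>J \<rightarrow>\<^sub>E {0<..}. B * W y \<sigma>)"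
      by simp
  next
    fix s assume s: "s > \<sigma>\<^sub>0"
    let ?e = "\<lambda>m. exp (- (\<mu> m * s))"
    let ?\<sigma> = "\<sigma>(i := s)"
    have prod: "(\<Prod>j\<in>insert i J. exp (- (\<mu> ((y(i := m)) j) * ?\<sigma> j))) = ?e m * W y \<sigma>" for m y
      using insert.hyps by (auto simp: W_def intro!: prod.cong arg_cong2[where f = "(*)"])
    have summ: "(\<lambda>(m, y). c (y(i := m)) * (?e m * W y \<sigma>)) summable_on
                  ({0<..} \<times> (J \<rightarrow>\<^sub>E {0<..}))"
    proof (rule abs_summable_summable[OF Infinite_Sum.abs_summable_on_comparison_test'])
      have "(\<lambda>(m, y). ?e m * W y \<sigma>) summable_on ({0<..} \<times> (J \<rightarrow>\<^sub>E {0<..}))"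
        by (intro has_sum_imp_summable[OF has_sum_times_nonneg[OF has_sum_infsum has_sum_infsum]]
            summable s W_summable \<sigma>) (auto simp: W_nonneg)
      then show "(\<lambda>p. B * (\<lambda>(m, y). ?e m * W y \<sigma>) p) summable_on ({0<..} \<times> (J \<rightarrow>\<^sub>E {0<..}))"
        by (rule summable_on_cmult_right)
    qed (use insert.prems(1) W_nonneg in \<open>auto simp: abs_mult intro!: mult_right_mono\<close>)
    have "0 = (\<Sum>\<^sub>\<infinity>k\<in>insert i J \<rightarrow>\<^sub>E {0<..}. c k * (\<Prod>j\<in>insert i J. exp (- (\<mu> (k j) * ?\<sigma> j))))"
      using \<sigma> s by (intro insert.prems(2)[symmetric]) auto
    also have "\<dots> = (\<Sum>\<^sub>\<infinity>(m, y)\<in>{0<..} \<times> (J \<rightarrow>\<^sub>E {0<..}). c (y(i := m)) * (?e m * W y \<sigma>))"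
      unfolding PiE_insert_eq
        infsum_reindex[OF inj_combinator[OF insert.hyps(2), where T = "\<lambda>_. {0<..}"]]
      unfolding o_def case_prod_unfold prod ..
    also have "\<dots> = (\<Sum>\<^sub>\<infinity>m\<in>{0<..}. \<Sum>\<^sub>\<infinity>y\<in>J \<rightarrow>\<^sub>E {0<..}. c (y(i := m)) * (?e m * W y \<sigma>))"
      by (rule infsum_Sigma'_banach[OF summ, symmetric])
    also have "\<dots> = (\<Sum>\<^sub>\<infinity>m\<in>{0<..}. (\<Sum>\<^sub>\<infinity>y\<in>J \<rightarrow>\<^sub>E {0<..}. c (y(i := m)) * W y \<sigma>) * ?e m)"
      unfolding infsum_cmult_left'[symmetric] by (simp only: mult_ac)
    finally show "\<dots> = 0" ..
  qed auto
  then have "c (y(i := m)) = 0"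
    unfolding W_def
    by (intro insert.IH[where c = "\<lambda>y. c (y(i := m))" and k = y] insert.prems(1) y)
  then show ?case by (simp only: k)
qed

section \<open>Vanishing of combinations is decided by the coefficients\<close>

lemma has_sum_finite_sum:
  fixes f :: "'h \<Rightarrow> 'a \<Rightarrow> real"
  assumes "\<And>h. h \<in> H \<Longrightarrow> (f h has_sum t h) A"
  shows "((\<lambda>x. \<Sum>h\<in>H. f h x) has_sum (\<Sum>h\<in>H. t h)) A"
  using assms by (induction H rule: infinite_finite_induct) (auto intro!: has_sum_add)

text \<open>
  The right-hand side does not mention \<open>\<mu>\<close>. This lets two instances with different exponents,
  one for the zeta values and one for the rational functions, be compared through it.
\<close>

lemma legal_combination_vanishes_iff:
  fixes \<mu> :: "nat \<Rightarrow> real" and a :: "'h \<Rightarrow> real"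
  assumes legal: "\<And>h. h \<in> H \<Longrightarrow> legal_data n (P h) (v h)"
    and mono: "strict_mono_on {0<..} \<mu>"
    and summable: "\<And>\<sigma>. \<sigma> > \<sigma>\<^sub>0 \<Longrightarrow> (\<lambda>m. exp (- (\<mu> m * \<sigma>))) summable_on {0<..}"
  shows "(\<forall>\<sigma>. (\<forall>j\<in>{1..n}. \<sigma> j > \<sigma>\<^sub>0) \<longrightarrow>
            (\<Sum>h\<in>H. a h * (\<Prod>A\<in>P h. \<Sum>\<^sub>\<infinity>ks\<in>decreasing_tuples (length (v h A)).
               \<Prod>r<length (v h A). \<Prod>j\<in>v h A ! r. exp (- (\<mu> (ks ! r) * \<sigma> j)))) = 0)
     \<longleftrightarrow> (\<forall>k\<in>{1..n} \<rightarrow>\<^sub>E {0<..}.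
            (\<Sum>h\<in>H. a h * of_bool (\<forall>A\<in>P h. decreasing_along (v h A) k)) = 0)"
proof -
  define c where "c k = (\<Sum>h\<in>H. a h * of_bool (\<forall>A\<in>P h. decreasing_along (v h A) k))" for k
  define t where "t h \<sigma> = (\<Prod>A\<in>P h. \<Sum>\<^sub>\<infinity>ks\<in>decreasing_tuples (length (v h A)).
      \<Prod>r<length (v h A). \<Prod>j\<in>v h A ! r. exp (- (\<mu> (ks ! r) * \<sigma> j)))" for h \<sigma>
  have expand: "(\<Sum>h\<in>H. a h * t h \<sigma>) =
      (\<Sum>\<^sub>\<infinity>k\<in>{1..n} \<rightarrow>\<^sub>E {0<..}. c k * (\<Prod>j\<in>{1..n}. exp (- (\<mu> (k j) * \<sigma> j))))"
    if "\<forall>j\<in>{1..n}. \<sigma> j > \<sigma>\<^sub>0" for \<sigma>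
  proof -
    have "((\<lambda>k. \<Sum>h\<in>H. a h * (of_bool (\<forall>A\<in>P h. decreasing_along (v h A) k) *
             (\<Prod>j\<in>{1..n}. exp (- (\<mu> (k j) * \<sigma> j))))) has_sum (\<Sum>h\<in>H. a h * t h \<sigma>))
          ({1..n} \<rightarrow>\<^sub>E {0<..})"
      unfolding t_def using that
      by (intro has_sum_finite_sum has_sum_cmult_right has_sum_legal_data legal summable) auto
    then show ?thesis
      by (simp add: infsumI c_def sum_distrib_right mult.assoc)
  qed
  have bound: "\<bar>c k\<bar> \<le> (\<Sum>h\<in>H. \<bar>a h\<bar>)" for k
    unfolding c_def by (rule order.trans[OF sum_abs]) (auto intro!: sum_mono)
  have "(\<forall>\<sigma>. (\<forall>j\<in>{1..n}. \<sigma> j > \<sigma>\<^sub>0) \<longrightarrow> (\<Sum>h\<in>H. a h * t h \<sigma>) = 0) \<longleftrightarrow>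
        (\<forall>k\<in>{1..n} \<rightarrow>\<^sub>E {0<..}. c k = 0)"
  proof safe
    fix k :: "nat \<Rightarrow> nat" assume k: "k \<in> {1..n} \<rightarrow>\<^sub>E {0<..}"
      and *: "\<forall>\<sigma>. (\<forall>j\<in>{1..n}. \<sigma> j > \<sigma>\<^sub>0) \<longrightarrow> (\<Sum>h\<in>H. a h * t h \<sigma>) = 0"
    show "c k = 0"
    proof (rule multiple_dirichlet_series_unique[where \<sigma>\<^sub>0 = \<sigma>\<^sub>0 and c = c and J = "{1..n}"
          and k = k, OF finite_atLeastAtMost mono summable bound _ k])
      fix \<sigma> :: "nat \<Rightarrow> real" assume \<sigma>: "\<forall>j\<in>{1..n}. \<sigma> j > \<sigma>\<^sub>0"
      show "(\<Sum>\<^sub>\<infinity>k\<in>{1..n} \<rightarrow>\<^sub>E {0<..}. c k * (\<Prod>j\<in>{1..n}. exp (- (\<mu> (k j) * \<sigma> j)))) = 0"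
        unfolding expand[OF \<sigma>, symmetric] by (rule *[THEN spec, THEN mp, OF \<sigma>])
    qed
  next
    fix \<sigma> :: "nat \<Rightarrow> real" assume "\<forall>j\<in>{1..n}. \<sigma> j > \<sigma>\<^sub>0" "\<forall>k\<in>{1..n} \<rightarrow>\<^sub>E {0<..}. c k = 0"
    then show "(\<Sum>h\<in>H. a h * t h \<sigma>) = 0"
      by (subst expand) (auto intro!: infsum_0)
  qed
  then show ?thesis by (simp only: c_def t_def)
qed

section \<open>Zeta values and rational functions as sums over decreasing tuples\<close>

lemma multi_zeta_blocks:
  assumes "\<And>r. r < length ps \<Longrightarrow> finite (ps ! r)"
  shows "multi_zeta (map (\<lambda>B. \<Sum>j\<in>B. s j) ps) =
         (\<Sum>\<^sub>\<infinity>ks\<in>decreasing_tuples (length ps).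
            \<Prod>r<length ps. \<Prod>j\<in>ps ! r. exp (- (ln (real (ks ! r)) * s j)))"
  unfolding multi_zeta_def decreasing_tuples_def
proof (simp, intro infsum_cong prod.cong refl)
  fix ks :: "nat list" and r assume ks: "ks \<in> {k. length k = length ps \<and> sorted_wrt (>) k \<and> (\<forall>i\<in>set k. 0 < i)}"
    and r: "r \<in> {..<length ps}"
  then have "ks ! r > 0" by auto
  then have "real (ks ! r) powr - (\<Sum>j\<in>ps ! r. s j) = exp (\<Sum>j\<in>ps ! r. - (ln (real (ks ! r)) * s j))"
    by (simp add: powr_def sum_distrib_right sum_negf mult.commute)
  then show "real (ks ! r) powr - (sum s (ps ! r)) =
      (\<Prod>j\<in>ps ! r. exp (- (ln (real (ks ! r)) * s j)))"
    using assms r by (simp add: exp_sum)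
qed

text \<open>
  Induction from the last entry: subtracting the smallest entry \<open>m\<close> from the others leaves an
  arbitrary shorter decreasing tuple, and the powers taken out this way form the geometric series
  in the inverse of the full product \<open>Y\<close>, which sums to the last factor \<open>1 / (Y - 1)\<close>.
\<close>

lemma has_sum_decreasing_tuples:
  assumes "\<And>y. y \<in> set ys \<Longrightarrow> y > (1 :: real)"
  shows "((\<lambda>ks. \<Prod>r<length ys. inverse (ys ! r) ^ (ks ! r)) has_sum
          (\<Prod>b<length ys. inverse ((\<Prod>l\<le>b. ys ! l) - 1))) (decreasing_tuples (length ys))"
  using assms
proof (induction ys rule: rev_induct)
  case Nil
  have "decreasing_tuples 0 = {[]}" by (auto simp: decreasing_tuples_def)
  then show ?case by (simp add: has_sum_finite_iff)
next
  case (snoc y ys)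
  define Y where "Y = (\<Prod>l<length ys. ys ! l) * y"
  let ?\<alpha> = "length ys"
  let ?F = "\<lambda>ys (ks :: nat list). \<Prod>r<length ys. inverse (ys ! r :: real) ^ (ks ! r)"
  have "Y > 1"
  proof -
    have "(\<Prod>l<?\<alpha>. ys ! l) \<ge> 1" using snoc.prems by (intro prod_ge_1) (auto intro: less_imp_le)
    moreover have "y > 1" using snoc.prems by simp
    ultimately have "1 * 1 < (\<Prod>l<?\<alpha>. ys ! l) * y"
      by (intro mult_le_less_imp_less) auto
    then show ?thesis by (simp add: Y_def)
  qed
  have geom: "((\<lambda>m. inverse Y ^ m) has_sum inverse (Y - 1)) {0<..}"
  proof -
    have "inverse Y / (1 - inverse Y) = inverse (Y - 1)"
      using \<open>Y > 1\<close> by (simp add: field_simps)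
    moreover have "{0<..} = {1 :: nat..}" by auto
    ultimately show ?thesis
      using has_sum_geometric_from_1[of "inverse Y"] \<open>Y > 1\<close> by (simp add: field_simps)
  qed
  have "((\<lambda>(m, ks). inverse Y ^ m * ?F ys ks) has_sum
      (inverse (Y - 1) * (\<Prod>b<?\<alpha>. inverse ((\<Prod>l\<le>b. ys ! l) - 1)))) ({0<..} \<times> decreasing_tuples ?\<alpha>)"
  proof (intro has_sum_times_nonneg geom snoc.IH)
    have "inverse (ys ! r) \<ge> 0" if "r < ?\<alpha>" for r
      using snoc.prems[of "ys ! r"] that by simp
    then show "?F ys ks \<ge> 0" for ks by (auto intro!: prod_nonneg)
  qed (use snoc.prems \<open>Y > 1\<close> in auto)
  also have "?this \<longleftrightarrow> (?F (ys @ [y]) has_sum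
      (inverse (Y - 1) * (\<Prod>b<?\<alpha>. inverse ((\<Prod>l\<le>b. ys ! l) - 1)))) (decreasing_tuples (Suc ?\<alpha>))"
  proof (rule has_sum_reindex_bij_witness[where
        j = "\<lambda>(m, ks). map (\<lambda>i. i + m) ks @ [m]" and
        i = "\<lambda>ks. (last ks, map (\<lambda>i. i - last ks) (butlast ks))"], goal_cases)
    case (1 p)
    then show ?case by (auto simp: o_def)
  next
    case (2 p)
    then show ?case by (auto simp: decreasing_tuples_def sorted_wrt_append sorted_wrt_map)
  next
    case (3 ks)
    then obtain ks' m where ks: "ks = ks' @ [m]"
      by (cases ks rule: rev_cases) (auto simp: decreasing_tuples_def)
    with 3 show ?case
      by (auto simp: decreasing_tuples_def sorted_wrt_append intro!: map_idI)
  next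
    case (4 ks)
    then obtain ks' m where ks: "ks = ks' @ [m]"
      by (cases ks rule: rev_cases) (auto simp: decreasing_tuples_def)
    with 4 show ?case
      by (auto simp: decreasing_tuples_def sorted_wrt_append sorted_wrt_map
          elim!: sorted_wrt_mono_rel[rotated] intro: diff_less_mono)
  next
    case (5 p)
    then obtain m ks where p: "p = (m, ks)" "length ks = ?\<alpha>"
      by (auto simp: decreasing_tuples_def)
    have "?F (ys @ [y]) (map (\<lambda>i. i + m) ks @ [m]) =
        (\<Prod>r<?\<alpha>. inverse (ys ! r) ^ (ks ! r) * inverse (ys ! r) ^ m) * inverse y ^ m"
      using p by (simp add: nth_append power_add)
    also have "\<dots> = inverse Y ^ m * ?F ys ks"
      by (simp add: Y_def prod.distrib power_mult_distrib prod_inversef[unfolded o_def] flip: prod_power_distrib)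
    finally show ?case using p by simp
  qed auto
  also have "inverse (Y - 1) * (\<Prod>b<?\<alpha>. inverse ((\<Prod>l\<le>b. ys ! l) - 1)) =
      (\<Prod>b<length (ys @ [y]). inverse ((\<Prod>l\<le>b. (ys @ [y]) ! l) - 1))"
    by (simp add: Y_def nth_append lessThan_Suc_atMost[symmetric])
  finally show ?case by simp
qed

lemma rational_factor_blocks:
  assumes "\<And>r. r < length ps \<Longrightarrow> finite (ps ! r) \<and> ps ! r \<noteq> {}"
    and x: "\<And>r j. r < length ps \<Longrightarrow> j \<in> ps ! r \<Longrightarrow> x j > 1"
  shows "(\<Prod>b<length ps. inverse ((\<Prod>l\<le>b. \<Prod>j\<in>ps ! l. x j) - 1)) =
         (\<Sum>\<^sub>\<infinity>ks\<in>decreasing_tuples (length ps).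
            \<Prod>r<length ps. \<Prod>j\<in>ps ! r. exp (- (real (ks ! r) * ln (x j))))"
proof -
  let ?ys = "map (\<lambda>B. \<Prod>j\<in>B. x j) ps"
  have "\<And>y. y \<in> set ?ys \<Longrightarrow> y > 1"
    using assms by (auto simp: in_set_conv_nth intro!: less_1_prod)
  note * = infsumI[OF has_sum_decreasing_tuples[OF this], symmetric]
  have "(\<Prod>b<length ps. inverse ((\<Prod>l\<le>b. \<Prod>j\<in>ps ! l. x j) - 1)) =
        (\<Prod>b<length ?ys. inverse ((\<Prod>l\<le>b. ?ys ! l) - 1))"
    by (auto intro!: prod.cong arg_cong[where f = inverse])
  also have "\<dots> = (\<Sum>\<^sub>\<infinity>ks\<in>decreasing_tuples (length ps).
      \<Prod>r<length ps. inverse (\<Prod>j\<in>ps ! r. x j) ^ (ks ! r))"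
    by (subst *) auto
  also have "\<dots> = (\<Sum>\<^sub>\<infinity>ks\<in>decreasing_tuples (length ps).
      \<Prod>r<length ps. \<Prod>j\<in>ps ! r. exp (- (real (ks ! r) * ln (x j))))"
  proof (intro infsum_cong prod.cong refl)
    fix ks :: "nat list" and r assume r: "r \<in> {..<length ps}"
    have "exp (- (real m * ln (x j))) = inverse (x j) ^ m" if "j \<in> ps ! r" for j m
      using x[of r j] r that by (simp add: exp_minus exp_of_nat_mult power_inverse)
    then show "inverse (\<Prod>j\<in>ps ! r. x j) ^ (ks ! r) =
        (\<Prod>j\<in>ps ! r. exp (- (real (ks ! r) * ln (x j))))"
      by (simp add: prod_inversef[unfolded o_def] flip: prod_power_distrib)
  qed
  finally show ?thesis .
qed

lemma legal_block:
  assumes "legal_data n P v" "A \<in> P" "r < length (v A)"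
  shows "finite (v A ! r)" "v A ! r \<noteq> {}" "v A ! r \<subseteq> {1..n}"
proof -
  have "ordered_set_partition A (v A)" "A \<subseteq> {1..n}"
    using assms by (auto simp: legal_data_def partition_on_def)
  with assms(3) show "v A ! r \<subseteq> {1..n}" "v A ! r \<noteq> {}"
    unfolding ordered_set_partition_def by (metis Union_upper nth_mem order.trans, metis nth_mem)
  then show "finite (v A ! r)" by (auto intro: finite_subset)
qed

section \<open>Equivalence of the two vanishing conditions\<close>

theorem theorem1:
  fixes n q :: nat
    and a :: "nat \<Rightarrow> int"
    and P :: "nat \<Rightarrow> nat set set"
    and v :: "nat \<Rightarrow> nat set \<Rightarrow> nat set list"
  assumes "n \<ge> 1" and "q \<ge> 1"
    and "\<And>h. h \<in> {1..q} \<Longrightarrow> legal_data n (P h) (v h)"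
  shows "(\<forall>s :: nat \<Rightarrow> real. (\<forall>j\<in>{1..n}. s j > 1) \<longrightarrow>
            (\<Sum>h=1..q. of_int (a h) * legal_term (P h) (v h) s) = 0)
     \<longleftrightarrow> (\<forall>x :: nat \<Rightarrow> real. (\<forall>j\<in>{1..n}. x j > 1) \<longrightarrow>
            (\<Sum>h=1..q. of_int (a h) * rational_fun (P h) (v h) x) = 0)"
proof -
  note legal = assms(3)
  define t where "t \<mu> h \<sigma> = (\<Prod>A\<in>P h. \<Sum>\<^sub>\<infinity>ks\<in>decreasing_tuples (length (v h A)).
      \<Prod>r<length (v h A). \<Prod>j\<in>v h A ! r. exp (- (\<mu> (ks ! r) * \<sigma> j)))"
    for \<mu> :: "nat \<Rightarrow> real" and h and \<sigma> :: "nat \<Rightarrow> real"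
  define vanishing where "vanishing \<longleftrightarrow> (\<forall>k\<in>{1..n} \<rightarrow>\<^sub>E {0<..}.
      (\<Sum>h\<in>{1..q}. real_of_int (a h) * of_bool (\<forall>A\<in>P h. decreasing_along (v h A) k)) = 0)"
  have zeta: "legal_term (P h) (v h) s = t (\<lambda>m. ln (real m)) h s" if "h \<in> {1..q}" for h s
    unfolding legal_term_def t_def using legal_block[OF legal[OF that]]
    by (intro prod.cong refl multi_zeta_blocks)
  have rat: "rational_fun (P h) (v h) x = t real h (\<lambda>j. ln (x j))"
    if "h \<in> {1..q}" "\<forall>j\<in>{1..n}. x j > 1" for h x
    unfolding rational_fun_def t_def using legal_block[OF legal[OF that(1)]] that(2)
    by (intro prod.cong refl rational_factor_blocks) blast+
  have "(\<lambda>m. exp (- (ln (real m) * \<sigma>))) summable_on {0<..}" if "\<sigma> > 1" for \<sigma>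
  proof -
    have "(\<lambda>m. real m powr - \<sigma>) summable_on UNIV"
      using that by (intro summable_nonneg_imp_summable_on) (auto simp: summable_real_powr_iff)
    then have "(\<lambda>m. real m powr - \<sigma>) summable_on {0<..}"
      by (rule summable_on_subset_banach) auto
    then show ?thesis
      by (rule summable_on_cong[THEN iffD1, rotated]) (auto simp: powr_def mult.commute)
  qed
  \<comment> \<open>Exponents \<open>ln m\<close>, convergent for \<open>\<sigma> > 1\<close>.\<close>
  then have E: "(\<forall>s. (\<forall>j\<in>{1..n}. s j > 1) \<longrightarrow>
      (\<Sum>h=1..q. of_int (a h) * t (\<lambda>m. ln (real m)) h s) = 0) \<longleftrightarrow> vanishing"
    unfolding t_def vanishing_def
    by (intro legal_combination_vanishes_iff legal) (auto intro!: strict_mono_onI)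
  have "(\<lambda>m. exp (- (real m * \<sigma>))) summable_on {0<..}" if "\<sigma> > 0" for \<sigma>
  proof -
    have "(\<lambda>m. exp (- \<sigma>) ^ m) summable_on UNIV"
      using that by (intro summable_nonneg_imp_summable_on summable_geometric) auto
    then have "(\<lambda>m. exp (- \<sigma>) ^ m) summable_on {0<..}"
      by (rule summable_on_subset_banach) auto
    then show ?thesis by (simp flip: exp_of_nat_mult)
  qed
  \<comment> \<open>Exponents \<open>m\<close>, convergent for \<open>\<sigma> > 0\<close>, that is \<open>x = exp \<sigma> > 1\<close>.\<close>
  then have L: "(\<forall>\<sigma>. (\<forall>j\<in>{1..n}. \<sigma> j > 0) \<longrightarrow>
      (\<Sum>h=1..q. of_int (a h) * t real h \<sigma>) = 0) \<longleftrightarrow> vanishing"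
    unfolding t_def vanishing_def
    by (intro legal_combination_vanishes_iff legal) (auto intro!: strict_mono_onI)
  have "(\<forall>x. (\<forall>j\<in>{1..n}. x j > 1) \<longrightarrow>
          (\<Sum>h=1..q. of_int (a h) * rational_fun (P h) (v h) x) = 0) \<longleftrightarrow>
        (\<forall>\<sigma>. (\<forall>j\<in>{1..n}. \<sigma> j > 0) \<longrightarrow> (\<Sum>h=1..q. of_int (a h) * t real h \<sigma>) = 0)"
  proof safe
    fix \<sigma> :: "nat \<Rightarrow> real"
    assume *: "\<forall>x. (\<forall>j\<in>{1..n}. x j > 1) \<longrightarrow>
        (\<Sum>h=1..q. of_int (a h) * rational_fun (P h) (v h) x) = 0" and "\<forall>j\<in>{1..n}. \<sigma> j > 0"
    then show "(\<Sum>h=1..q. of_int (a h) * t real h \<sigma>) = 0"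
      using *[rule_format, of "\<lambda>j. exp (\<sigma> j)"] by (simp add: rat)
  next
    fix x :: "nat \<Rightarrow> real"
    assume *: "\<forall>\<sigma>. (\<forall>j\<in>{1..n}. \<sigma> j > 0) \<longrightarrow> (\<Sum>h=1..q. of_int (a h) * t real h \<sigma>) = 0"
      and x: "\<forall>j\<in>{1..n}. x j > 1"
    have "(\<Sum>h=1..q. of_int (a h) * t real h (\<lambda>j. ln (x j))) = 0"
      using x by (intro *[rule_format]) (auto intro: ln_gt_zero)
    then show "(\<Sum>h=1..q. of_int (a h) * rational_fun (P h) (v h) x) = 0"
      using x by (simp add: rat)
  qed
  with E L show ?thesis by (simp add: zeta)
qed

end
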